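(* Let $\Omega\subset\mathbb{R}^n$ be a bounded open set, let $N\ge 1$, $r>0$, and let $B_1,\dots,B_N\subset\Omega$ be pairwise disjoint open balls of radius $r$. Let $D\subset\mathbb{R}^n$ be an open box containing $\Omega$, sufficiently large that $d\big(x,\bigcup_{i=1}^N B_i\big)<d(x,\partial D)$ for every $x\in\Omega$. For every $\varepsilon>0$ let $w_\varepsilon$ be the solution of $$\begin{cases} w_\varepsilon-\varepsilon\,\Delta w_\varepsilon=0 & \text{in } D\setminus\bigcup_{i=1}^N \overline{B_i},\\ w_\varepsilon=1 & \text{on } \bigcup_{i=1}^N\partial B_i\cup\partial D,\end{cases}$$ and set $v_\varepsilon(x):=-\sqrt{\varepsilon}\,\ln w_\varepsilon(x)$. Then, as $\varepsilon\to 0$, $v_\varepsilon$ converges uniformly on $\Omega\setminus\bigcup_{i=1}^N B_i$ to the function $x\mapsto d\big(x,\bigcup_{i=1}^N B_i\big)$. More precisely, there exists a constant $C$ depending only on $D$ and $(B_i)_{1\le i\le N}$ such that $$\forall \varepsilon>0,\ \forall x\in\Omega\setminus\bigcup_{i=1}^N B_i,\qquad \Big|v_\varepsilon(x)-d\big(x,\textstyle\bigcup_{i=1}^N B_i\big)\Big|\le C\,\varepsilon^{1/4}.$$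
   Context: For $x\in\mathbb{R}^n$ and a nonempty set $A\subset\mathbb{R}^n$, $d(x,A):=\inf_{y\in A}\|x-y\|$, with $\|\cdot\|$ the Euclidean norm. A box is a product of $n$ bounded open intervals. The solution $w_\varepsilon$ is the classical solution, continuous up to the boundary and hence defined, with value $1$, on each $\partial B_i$. *)

theory Defs
  imports "HOL-Analysis.Analysis"
begin

definition partial_deriv :: "'n::finite \<Rightarrow> (real^'n \<Rightarrow> real) \<Rightarrow> real^'n \<Rightarrow> real" where
  "partial_deriv i f x = frechet_derivative f (at x) (axis i 1)"

definition laplacian :: "(real^'n::finite \<Rightarrow> real) \<Rightarrow> real^'n \<Rightarrow> real" where
  "laplacian f x = (\<Sum>i\<in>UNIV. partial_deriv i (partial_deriv i f) x)"

text \<open>The class \<open>C\<^sup>2(U)\<close>; meant for open \<open>U\<close>, where continuity of the first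
  partial derivatives follows from their differentiability.\<close>

definition C2_on :: "(real^'n::finite) set \<Rightarrow> (real^'n \<Rightarrow> real) \<Rightarrow> bool" where
  "C2_on U f \<longleftrightarrow>
     f differentiable_on U \<and>
     (\<forall>i. partial_deriv i f differentiable_on U) \<and>
     (\<forall>i j. continuous_on U (partial_deriv i (partial_deriv j f)))"

text \<open>Classical solutions of \<open>w - \<epsilon> \<Delta>w = 0\<close> in \<open>D\<close> minus the closures of the \<open>B i\<close>, with boundary
  value 1. Continuity is required on \<open>closure D - (\<Union>i\<in>I. B i)\<close> rather than on the closure of
  the domain of the equation: the two differ when \<open>n = 1\<close> and two of the intervals \<open>B i\<close> share an
  endpoint, which then is not a limit of points of that domain. The values of \<open>w\<close> outside
  this set are irrelevant.\<close>

definition classical_solution ::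
  "(real^'n::finite) set \<Rightarrow> 'i set \<Rightarrow> ('i \<Rightarrow> (real^'n) set) \<Rightarrow> real \<Rightarrow> (real^'n \<Rightarrow> real) \<Rightarrow> bool" where
  "classical_solution D I B \<epsilon> w \<longleftrightarrow>
     C2_on (D - (\<Union>i\<in>I. closure (B i))) w \<and>
     continuous_on (closure D - (\<Union>i\<in>I. B i)) w \<and>
     (\<forall>x \<in> D - (\<Union>i\<in>I. closure (B i)). w x - \<epsilon> * laplacian w x = 0) \<and>
     (\<forall>x \<in> (\<Union>i\<in>I. frontier (B i)) \<union> frontier D. w x = 1)"

end

(* With h = sqrt epsilon, the functions exp (-(|x - c| - r) / h) are supersolutions outside the
   ball of centre c and radius r, and become subsolutions when 1 / h is replaced by
   1 / h + (n - 1) / r; exponentials of coordinates solve the equation exactly. By the maximum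
   principle, w lies below the sum of these supersolutions over the balls and of the coordinate
   exponentials over the 2n faces of the box, which gives v >= d - h ln (N + 2n), and above each
   subsolution, which gives v <= d (1 + h (n - 1) / r). Both errors are O(sqrt epsilon) for
   epsilon <= 1, and v is bounded uniformly in epsilon. *)

theory Submission
  imports Defs
begin

section \<open>Laplacians through second derivatives along the axes\<close>

text \<open>At a maximum only the derivatives along the axes matter. One-variable derivatives at
  \<open>t = 0\<close> keep the explicit barriers within the reach of the \<open>DERIV\<close>
  rules; no Frechet derivative has to be computed for them.\<close>

definition axis_derivatives ::
  "(real^'n::finite \<Rightarrow> real) \<Rightarrow> ('n \<Rightarrow> real^'n \<Rightarrow> real) \<Rightarrow> ('n \<Rightarrow> real^'n \<Rightarrow> real) \<Rightarrow>
    (real^'n) set \<Rightarrow> bool" where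
  "axis_derivatives f f1 f2 U \<longleftrightarrow> (\<forall>x\<in>U. \<forall>i.
     ((\<lambda>t. f (x + t *\<^sub>R axis i 1)) has_real_derivative f1 i x) (at 0) \<and>
     ((\<lambda>t. f1 i (x + t *\<^sub>R axis i 1)) has_real_derivative f2 i x) (at 0))"

text \<open>A relation with derivative witnesses rather than an operator: differences, sums and
  barriers are handled by exhibiting \<open>f1\<close> and \<open>f2\<close>.\<close>

definition has_laplacian ::
  "(real^'n::finite \<Rightarrow> real) \<Rightarrow> (real^'n \<Rightarrow> real) \<Rightarrow> (real^'n) set \<Rightarrow> bool" where
  "has_laplacian f l U \<longleftrightarrow>
     (\<exists>f1 f2. axis_derivatives f f1 f2 U \<and> (\<forall>x\<in>U. l x = (\<Sum>i\<in>UNIV. f2 i x)))"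

lemma has_laplacianI:
  assumes "\<And>x i. x \<in> U \<Longrightarrow> ((\<lambda>t. f (x + t *\<^sub>R axis i 1)) has_real_derivative f1 i x) (at 0)"
    and "\<And>x i. x \<in> U \<Longrightarrow> ((\<lambda>t. f1 i (x + t *\<^sub>R axis i 1)) has_real_derivative f2 i x) (at 0)"
    and "\<And>x. x \<in> U \<Longrightarrow> l x = (\<Sum>i\<in>UNIV. f2 i x)"
  shows "has_laplacian f l U"
  unfolding has_laplacian_def axis_derivatives_def
  by (intro exI[of _ f1] exI[of _ f2]) (simp add: assms)

lemma has_laplacian_diff:
  assumes "has_laplacian f l U" "has_laplacian g m U"
  shows "has_laplacian (\<lambda>x. f x - g x) (\<lambda>x. l x - m x) U"
proof -
  obtain f1 f2 where f: "axis_derivatives f f1 f2 U" "\<forall>x\<in>U. l x = (\<Sum>i\<in>UNIV. f2 i x)"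
    using assms(1) unfolding has_laplacian_def by blast
  obtain g1 g2 where g: "axis_derivatives g g1 g2 U" "\<forall>x\<in>U. m x = (\<Sum>i\<in>UNIV. g2 i x)"
    using assms(2) unfolding has_laplacian_def by blast
  show ?thesis
    by (rule has_laplacianI[where ?f1.0 = "\<lambda>i x. f1 i x - g1 i x"
          and ?f2.0 = "\<lambda>i x. f2 i x - g2 i x"])
      (use f g in \<open>auto simp: axis_derivatives_def sum_subtractf intro!: DERIV_diff\<close>)
qed

lemma has_laplacian_sum:
  assumes "\<And>k. k \<in> J \<Longrightarrow> has_laplacian (f k) (l k) U"
  shows "has_laplacian (\<lambda>x. \<Sum>k\<in>J. f k x) (\<lambda>x. \<Sum>k\<in>J. l k x) U"
proof -
  \<comment> \<open>Both witnesses are packed into one pair, so that a single use of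
    \<open>bchoice\<close> selects them for all \<open>k\<close>.\<close>
  have "\<forall>k\<in>J. \<exists>f12. axis_derivatives (f k) (fst f12) (snd f12) U \<and>
      (\<forall>x\<in>U. l k x = (\<Sum>i\<in>UNIV. snd f12 i x))"
    using assms unfolding has_laplacian_def by auto
  from bchoice[OF this] obtain F where F: "\<And>k. k \<in> J \<Longrightarrow>
      axis_derivatives (f k) (fst (F k)) (snd (F k)) U"
      "\<And>k x. k \<in> J \<Longrightarrow> x \<in> U \<Longrightarrow> l k x = (\<Sum>i\<in>UNIV. snd (F k) i x)"
    by blast
  show ?thesis
  proof (rule has_laplacianI[where ?f1.0 = "\<lambda>i x. \<Sum>k\<in>J. fst (F k) i x"
          and ?f2.0 = "\<lambda>i x. \<Sum>k\<in>J. snd (F k) i x"])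
    show "(\<Sum>k\<in>J. l k x) = (\<Sum>i\<in>UNIV. \<Sum>k\<in>J. snd (F k) i x)" if "x \<in> U" for x
      using F(2) that by (subst sum.swap) (auto intro!: sum.cong)
  qed (use F(1) in \<open>auto simp: axis_derivatives_def intro!: DERIV_sum\<close>)
qed

text \<open>Only the direction \<open>j\<close> contributes. The sign of \<open>s\<close> is free:
  both signs serve the faces of the box, and \<open>s = 0\<close> gives constants.\<close>

lemma has_laplacian_exp_coord:
  "has_laplacian (\<lambda>x::real^'n. exp (s * x $ j + q)) (\<lambda>x. s\<^sup>2 * exp (s * x $ j + q)) U"
proof -
  let ?d = "\<lambda>i. if i = j then s else 0"
  have coord: "((\<lambda>t. s * (x + t *\<^sub>R axis i 1) $ j + q) has_real_derivative ?d i) (at 0)" 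
    for x :: "real^'n" and i
    by (auto simp: axis_def intro!: derivative_eq_intros)
  have expd: "((\<lambda>t. exp (s * (x + t *\<^sub>R axis i 1) $ j + q)) has_real_derivative
      exp (s * x $ j + q) * ?d i) (at 0)" for x :: "real^'n" and i
    using DERIV_chain'[OF coord[of x i] DERIV_exp] by (simp add: mult.commute)
  show ?thesis
  proof (rule has_laplacianI[where ?f1.0 = "\<lambda>i x. exp (s * x $ j + q) * ?d i"
          and ?f2.0 = "\<lambda>i x. exp (s * x $ j + q) * ?d i * ?d i"])
    show "s\<^sup>2 * exp (s * x $ j + q) = (\<Sum>i\<in>UNIV. exp (s * x $ j + q) * ?d i * ?d i)" for x :: "real^'n"
      by (simp add: power2_eq_square if_distrib[of "\<lambda>z. _ * z"] cong: if_cong)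
  qed (rule expd, rule DERIV_cmult_right[OF expd])
qed

text \<open>The gradient of the norm away from the origin is \<open>sgn\<close>; its inner product
  with the axis vector is the \<open>i\<close>-th component.\<close>

lemma norm_axis_has_derivative:
  fixes x c :: "real^'n"
  assumes "x \<noteq> c"
  shows "((\<lambda>t. norm (x + t *\<^sub>R axis i 1 - c)) has_real_derivative (x$i - c$i) / norm (x - c)) (at 0)"
proof -
  have "((\<lambda>t. norm (x + t *\<^sub>R axis i 1 - c)) has_derivative
      (\<lambda>t. inner (t *\<^sub>R axis i 1) (sgn (x - c)))) (at (0::real))"
    by (rule has_derivative_compose[of "\<lambda>t. x + t *\<^sub>R axis i 1 - c" _ _ _ norm])
      (use assms in \<open>auto intro!: derivative_eq_intros has_derivative_norm\<close>)
  then show ?thesis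
    by (rule has_derivative_imp_has_field_derivative)
      (simp add: sgn_div_norm inner_axis' divide_simps)
qed

text \<open>This is the radial formula \<phi>'' + (n - 1) \<phi>' / \<rho> with \<rho> =
  \<open>norm (x - c)\<close>, \<phi>' = - s \<phi> and \<phi>'' = s * s * \<phi>. The centre, where
  the norm is not differentiable, must lie outside \<open>U\<close>.\<close>

lemma has_laplacian_exp_norm:
  fixes c :: "real^'n"
  assumes "c \<notin> U"
  shows "has_laplacian (\<lambda>x. exp (- s * (norm (x - c) - r)))
    (\<lambda>x. exp (- s * (norm (x - c) - r)) * (s\<^sup>2 - s * (real CARD('n) - 1) / norm (x - c))) U"
proof -
  let ?\<phi> = "\<lambda>x. exp (- s * (norm (x - c) - r))"
  let ?u = "\<lambda>i x. (x$i - c$i) / norm (x - c)"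
  have 1: "((\<lambda>t. ?\<phi> (x + t *\<^sub>R axis i 1)) has_real_derivative - s * ?\<phi> x * ?u i x) (at 0)"
    if "x \<in> U" for x i
    using that assms by (auto intro!: derivative_eq_intros norm_axis_has_derivative)
  have coord: "((\<lambda>t. (x + t *\<^sub>R axis i 1) $ i - c $ i) has_real_derivative 1) (at 0)"
    for x :: "real^'n" and i
    by (auto simp: axis_def intro!: derivative_eq_intros)
  have 2: "((\<lambda>t. ?u i (x + t *\<^sub>R axis i 1)) has_real_derivative
      1 / norm (x - c) - (x$i - c$i)\<^sup>2 / norm (x - c) ^ 3) (at 0)" if "x \<in> U" for x i
  proof -
    have ne: "x \<noteq> c" using that assms by auto
    show ?thesis
      by (rule DERIV_cong[OF DERIV_divide[OF coord norm_axis_has_derivative[OF ne]]])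
        (use ne in \<open>auto simp: field_simps power2_eq_square power3_eq_cube\<close>)
  qed
  \<comment> \<open>The shape in which \<open>DERIV_mult\<close> delivers the derivative:
    \<open>p\<close> is the exponential, \<open>u\<close> the component of the unit vector and
    \<open>q\<close> the derivative of \<open>u\<close>.\<close>
  have product: "- s * (- s * p * u) * u + q * (- s * p) = - s * p * q + s\<^sup>2 * p * u\<^sup>2"
    for p q u by (simp add: power2_eq_square algebra_simps)
  show ?thesis
  proof (rule has_laplacianI[where ?f1.0 = "\<lambda>i x. - s * ?\<phi> x * ?u i x" and
        ?f2.0 = "\<lambda>i x. - s * ?\<phi> x * (1 / norm (x - c) - (x$i - c$i)\<^sup>2 / norm (x - c) ^ 3)
                     + s\<^sup>2 * ?\<phi> x * (?u i x)\<^sup>2"])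
    show "((\<lambda>t. - s * ?\<phi> (x + t *\<^sub>R axis i 1) * ?u i (x + t *\<^sub>R axis i 1)) has_real_derivative
      - s * ?\<phi> x * (1 / norm (x - c) - (x$i - c$i)\<^sup>2 / norm (x - c) ^ 3)
                     + s\<^sup>2 * ?\<phi> x * (?u i x)\<^sup>2) (at 0)" if "x \<in> U" for x i
      by (rule DERIV_cong[OF DERIV_mult[OF DERIV_cmult[OF 1[OF that, of i], of "- s"] 2[OF that, of i]]])
        (rule trans[OF _ product], simp)
  next
    fix x assume "x \<in> U"
    then have \<rho>: "norm (x - c) > 0" using assms by auto
    \<comment> \<open>The unit vector has norm 1, so the derivatives of its components add up to n /
      \<rho> - 1 / \<rho>.\<close>
    have sq: "(\<Sum>i\<in>UNIV. (x$i - c$i)\<^sup>2) = (norm (x - c))\<^sup>2"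
      by (simp add: norm_vec_def L2_set_def sum_nonneg)
    have "(\<Sum>i\<in>UNIV. - s * ?\<phi> x * (1 / norm (x - c) - (x$i - c$i)\<^sup>2 / norm (x - c) ^ 3)
                     + s\<^sup>2 * ?\<phi> x * (?u i x)\<^sup>2)
      = - s * ?\<phi> x * (real CARD('n) / norm (x - c) - (norm (x - c))\<^sup>2 / norm (x - c) ^ 3)
                     + s\<^sup>2 * ?\<phi> x * ((norm (x - c))\<^sup>2 / (norm (x - c))\<^sup>2)"
      by (simp only: sum.distrib sum_distrib_left[symmetric] sum_subtractf power_divide
          sum_divide_distrib[symmetric] sq) (simp add: sum_divide_distrib[symmetric] sq)
    also have "\<dots> = ?\<phi> x * (s\<^sup>2 - s * (real CARD('n) - 1) / norm (x - c))"
      using \<rho> by (simp add: field_simps power2_eq_square power3_eq_cube)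
    finally show "?\<phi> x * (s\<^sup>2 - s * (real CARD('n) - 1) / norm (x - c)) =
      (\<Sum>i\<in>UNIV. - s * ?\<phi> x * (1 / norm (x - c) - (x$i - c$i)\<^sup>2 / norm (x - c) ^ 3)
                     + s\<^sup>2 * ?\<phi> x * (?u i x)\<^sup>2)" by simp
  qed (use 1 in auto)
qed

text \<open>Chain rule along the line through \<open>x\<close>. It is applied to a solution and then
  to its partial derivatives, which connects \<open>laplacian\<close> with
  \<open>has_laplacian\<close>.\<close>

lemma differentiable_imp_axis_derivative:
  assumes "f differentiable_on U" "open U" "x \<in> U"
  shows "((\<lambda>t. f (x + t *\<^sub>R axis i 1)) has_real_derivative partial_deriv i f x) (at 0)"
proof -
  have "f differentiable (at x)"
    using assms by (metis at_within_open differentiable_on_def)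
  then have f: "(f has_derivative frechet_derivative f (at x)) (at (x + 0 *\<^sub>R axis i 1))"
    by (simp add: frechet_derivative_works)
  have "((\<lambda>t. f (x + t *\<^sub>R axis i 1)) has_derivative
      (\<lambda>t. frechet_derivative f (at x) (t *\<^sub>R axis i 1))) (at (0::real))"
    by (rule has_derivative_compose[where f = "\<lambda>t. x + t *\<^sub>R axis i 1" and g = f])
      (use f in \<open>auto intro!: derivative_eq_intros\<close>)
  moreover have "linear (frechet_derivative f (at x))"
    using f has_derivative_linear by blast
  ultimately show ?thesis
    by (intro has_derivative_imp_has_field_derivative)
      (auto simp: partial_deriv_def linear_scale mult.commute)
qed

lemma C2_on_has_laplacian:
  assumes "C2_on U f" "open U"
  shows "has_laplacian f (laplacian f) U"
  using assms unfolding C2_on_def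
  by (intro has_laplacianI[where ?f1.0 = "\<lambda>i. partial_deriv i f"
        and ?f2.0 = "\<lambda>i. partial_deriv i (partial_deriv i f)"])
    (auto intro: differentiable_imp_axis_derivative simp: laplacian_def)

section \<open>The maximum principle\<close>

text \<open>The first derivative vanishes at the maximum. If \<open>m\<close> were positive,
  \<open>f'\<close> would be positive just to the right of 0, and the mean value theorem would give
  a value above \<open>f 0\<close>.\<close>

lemma DERIV2_local_max_nonpos:
  fixes f :: "real \<Rightarrow> real"
  assumes "\<delta> > 0"
    and f: "\<And>t. \<bar>t\<bar> < \<delta> \<Longrightarrow> (f has_real_derivative f' t) (at t)"
    and f': "(f' has_real_derivative m) (at 0)"
    and max: "\<And>t. \<bar>t\<bar> < \<delta> \<Longrightarrow> f t \<le> f 0"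
  shows "m \<le> 0"
proof (rule ccontr)
  assume "\<not> m \<le> 0"
  then obtain \<eta> where "\<eta> > 0" and inc: "\<And>h. 0 < h \<Longrightarrow> h < \<eta> \<Longrightarrow> f' 0 < f' h"
    using DERIV_pos_inc_right[OF f'] by auto
  have "f' 0 = 0"
    using DERIV_local_max[OF f[of 0] \<open>\<delta> > 0\<close>] max \<open>\<delta> > 0\<close> by simp
  define h where "h = min \<delta> \<eta> / 2"
  have h: "0 < h" "h < \<delta>" "h < \<eta>" using \<open>\<delta> > 0\<close> \<open>\<eta> > 0\<close> by (auto simp: h_def)
  obtain z where "0 < z" "z < h" "f h - f 0 = (h - 0) * f' z"
    using MVT2[of 0 h f f'] h f by force
  moreover have "0 < h * f' z"
    using inc[of z] calculation h \<open>f' 0 = 0\<close> by simp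
  ultimately show False using max[of h] h by simp
qed

lemma has_laplacian_local_max_nonpos:
  fixes x :: "real^'n"
  assumes "has_laplacian f l U" "open U" "x \<in> U" and max: "\<And>y. y \<in> U \<Longrightarrow> f y \<le> f x"
  shows "l x \<le> 0"
proof -
  obtain f1 f2 where
    f1: "\<And>x i. x \<in> U \<Longrightarrow> ((\<lambda>t. f (x + t *\<^sub>R axis i 1)) has_real_derivative f1 i x) (at 0)" and
    f2: "\<And>x i. x \<in> U \<Longrightarrow> ((\<lambda>t. f1 i (x + t *\<^sub>R axis i 1)) has_real_derivative f2 i x) (at 0)" and
    l: "l x = (\<Sum>i\<in>UNIV. f2 i x)"
    using assms(1,3) unfolding has_laplacian_def axis_derivatives_def by blast
  obtain \<delta> where "\<delta> > 0" and "ball x \<delta> \<subseteq> U"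
    using assms openE by blast
  have inU: "x + t *\<^sub>R axis i 1 \<in> U" if "\<bar>t\<bar> < \<delta>" for t i
    using that \<open>ball x \<delta> \<subseteq> U\<close> by (auto simp: dist_norm subset_iff)
  have "f2 i x \<le> 0" for i
  proof (rule DERIV2_local_max_nonpos[OF \<open>\<delta> > 0\<close> _ f2[OF \<open>x \<in> U\<close>]])
    \<comment> \<open>The witnesses give derivatives at parameter 0 only; the one at
      \<open>t\<close> comes from the base point \<open>x + t *\<^sub>R axis i 1\<close> by a
      shift.\<close>
    show "((\<lambda>t. f (x + t *\<^sub>R axis i 1)) has_real_derivative f1 i (x + t *\<^sub>R axis i 1)) (at t)"
      if "\<bar>t\<bar> < \<delta>" for t
      using f1[OF inU[OF that], of i i]
        DERIV_shift[of "\<lambda>t. f (x + t *\<^sub>R axis i 1)" "f1 i (x + t *\<^sub>R axis i 1)" 0 t]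
      by (simp add: algebra_simps)
  qed (use max inU in auto)
  then show ?thesis unfolding l by (simp add: sum_nonpos)
qed

text \<open>The zero-order term does the work: at a maximum point in \<open>U\<close> one has
  \<open>l y \<le> 0\<close>, hence \<open>f y \<le> \<epsilon> * l y \<le> 0\<close>. A compact
  \<open>K\<close> around \<open>U\<close> replaces its closure, to match the set on which solutions
  are continuous.\<close>

lemma maximum_principle:
  fixes f :: "real^'n \<Rightarrow> real"
  assumes "has_laplacian f l U" "open U" "U \<subseteq> K" "compact K" "continuous_on K f"
    and bdry: "\<And>x. x \<in> K - U \<Longrightarrow> f x \<le> 0"
    and sub: "\<And>x. x \<in> U \<Longrightarrow> f x \<le> \<epsilon> * l x" and "\<epsilon> > 0" "x \<in> K"
  shows "f x \<le> 0"
proof -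
  obtain y where "y \<in> K" and y: "\<And>z. z \<in> K \<Longrightarrow> f z \<le> f y"
    using continuous_attains_sup[OF \<open>compact K\<close> _ \<open>continuous_on K f\<close>] \<open>x \<in> K\<close> by blast
  have "f y \<le> 0"
  proof (cases "y \<in> U")
    case True
    then have "l y \<le> 0"
      using has_laplacian_local_max_nonpos[OF assms(1,2)] y \<open>U \<subseteq> K\<close> by blast
    then show ?thesis using sub[OF True] \<open>\<epsilon> > 0\<close> 
      by (smt (verit) mult_nonneg_nonpos)
  qed (use bdry \<open>y \<in> K\<close> in auto)
  then show ?thesis using y[OF \<open>x \<in> K\<close>] by simp
qed

section \<open>Comparison with sub- and supersolutions on the perforated domain\<close>

locale perforated =
  fixes D :: "(real^'n) set" and I :: "nat set" and B :: "nat \<Rightarrow> (real^'n) set"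
    and \<epsilon> :: real and w :: "real^'n \<Rightarrow> real"
  assumes sol: "classical_solution D I B \<epsilon> w"
    and openD: "open D" and bddD: "bounded D" and finI: "finite I"
    and openB: "\<And>i. i \<in> I \<Longrightarrow> open (B i)" and eps: "\<epsilon> > 0"
begin

abbreviation "U \<equiv> D - (\<Union>i\<in>I. closure (B i))"
abbreviation "K \<equiv> closure D - (\<Union>i\<in>I. B i)"
abbreviation "\<Gamma> \<equiv> (\<Union>i\<in>I. frontier (B i)) \<union> frontier D"

lemma open_U: "open U"
  using openD finI by (intro open_Diff closed_UN) auto

lemma compact_K: "compact K"
  using bddD openB by (intro compact_diff open_UN) auto

lemma U_subset_K: "U \<subseteq> K"
  using closure_subset by blast

text \<open>Such a point is either outside the open set \<open>D\<close> but in its closure, or in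
  the closure of some open \<open>B i\<close> but not in \<open>B i\<close>. So the prescribed
  values cover all of \<open>K - U\<close>.\<close>

lemma K_minus_U: "x \<in> K - U \<Longrightarrow> x \<in> \<Gamma>"
  using openB openD by (auto simp: frontier_def interior_open)

lemma w_laplacian: "has_laplacian w (laplacian w) U"
  using sol C2_on_has_laplacian[OF _ open_U] unfolding classical_solution_def by blast

text \<open>The equation is linear, so \<open>\<psi> - w\<close> is again a subsolution; it is
  nonpositive on \<open>K - U\<close> because \<open>w\<close> equals 1 there.\<close>

lemma subsolution_le:
  assumes "has_laplacian \<psi> l U" "continuous_on K \<psi>"
    and "\<And>x. x \<in> U \<Longrightarrow> \<psi> x \<le> \<epsilon> * l x" "\<And>x. x \<in> K \<Longrightarrow> x \<in> \<Gamma> \<Longrightarrow> \<psi> x \<le> 1" "x \<in> K"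
  shows "\<psi> x \<le> w x"
proof -
  have "\<psi> x - w x \<le> 0"
  proof (rule maximum_principle[OF has_laplacian_diff[OF assms(1) w_laplacian] open_U U_subset_K
        compact_K _ _ _ eps \<open>x \<in> K\<close>])
    show "continuous_on K (\<lambda>x. \<psi> x - w x)"
      using sol assms(2) by (auto simp: classical_solution_def intro!: continuous_intros)
    show "\<psi> x - w x \<le> 0" if "x \<in> K - U" for x
      using assms(4)[of x] K_minus_U[OF that] that sol by (auto simp: classical_solution_def)
    show "\<psi> x - w x \<le> \<epsilon> * (l x - laplacian w x)" if "x \<in> U" for x
    proof -
      have "w x - \<epsilon> * laplacian w x = 0"
        using sol that unfolding classical_solution_def by blast
      then show ?thesis
        using assms(3)[OF that] by (simp add: right_diff_distrib)
    qed
  qed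
  then show ?thesis by simp
qed

text \<open>The same argument for \<open>w - \<psi>\<close>.\<close>

lemma supersolution_ge:
  assumes "has_laplacian \<psi> l U" "continuous_on K \<psi>"
    and "\<And>x. x \<in> U \<Longrightarrow> \<epsilon> * l x \<le> \<psi> x" "\<And>x. x \<in> K \<Longrightarrow> x \<in> \<Gamma> \<Longrightarrow> 1 \<le> \<psi> x" "x \<in> K"
  shows "w x \<le> \<psi> x"
proof -
  have "w x - \<psi> x \<le> 0"
  proof (rule maximum_principle[OF has_laplacian_diff[OF w_laplacian assms(1)] open_U U_subset_K
        compact_K _ _ _ eps \<open>x \<in> K\<close>])
    show "continuous_on K (\<lambda>x. w x - \<psi> x)"
      using sol assms(2) by (auto simp: classical_solution_def intro!: continuous_intros)
    show "w x - \<psi> x \<le> 0" if "x \<in> K - U" for x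
      using assms(4)[of x] K_minus_U[OF that] that sol by (auto simp: classical_solution_def)
    show "w x - \<psi> x \<le> \<epsilon> * (laplacian w x - l x)" if "x \<in> U" for x
    proof -
      have "w x - \<epsilon> * laplacian w x = 0"
        using sol that unfolding classical_solution_def by blast
      then show ?thesis
        using assms(3)[OF that] by (simp add: right_diff_distrib)
    qed
  qed
  then show ?thesis by simp
qed

end

section \<open>Distances to balls and to the boundary of a box\<close>

lemma infdist_ball_le:
  fixes x c :: "'a::euclidean_space"
  assumes "r > 0" "r \<le> norm (x - c)"
  shows "infdist x (ball c r) \<le> norm (x - c) - r"
proof -
  \<comment> \<open>The radial projection of \<open>x\<close> onto the sphere; it lies in the
    closure of the ball and so has distance 0 from it.\<close>
  define y where "y = c + (r / norm (x - c)) *\<^sub>R (x - c)"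
  have ne: "norm (x - c) > 0" using assms by linarith
  have "y \<in> closure (ball c r)"
    using assms ne by (simp add: y_def dist_norm)
  moreover have "dist x y = norm (x - c) - r"
  proof -
    have "x - y = (1 - r / norm (x - c)) *\<^sub>R (x - c)"
      by (simp add: y_def algebra_simps)
    then have "dist x y = \<bar>1 - r / norm (x - c)\<bar> * norm (x - c)"
      by (simp add: dist_norm)
    also have "\<dots> = norm (x - c) - r"
      using assms ne by (simp add: abs_of_nonneg field_simps)
    finally show ?thesis .
  qed
  ultimately show ?thesis
    using infdist_triangle[of x "ball c r" y] in_closure_iff_infdist_zero[of "ball c r" y] assms
    by auto
qed

text \<open>Take the index minimising \<open>norm (x - c i) - r\<close>. By the triangle inequality
  no point of any ball is closer to \<open>x\<close> than this minimum.\<close>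

lemma infdist_UN_balls_attained:
  fixes x :: "'a::real_normed_vector"
  assumes "finite I" "I \<noteq> {}" "r > 0"
  shows "\<exists>i\<in>I. norm (x - c i) - r \<le> infdist x (\<Union>i\<in>I. ball (c i) r)"
proof -
  define m where "m = Min ((\<lambda>i. norm (x - c i) - r) ` I)"
  have "m \<in> (\<lambda>i. norm (x - c i) - r) ` I"
    unfolding m_def using assms by (intro Min_in) auto
  moreover have "m \<le> infdist x (\<Union>i\<in>I. ball (c i) r)"
  proof -
    have ne: "(\<Union>i\<in>I. ball (c i) r) \<noteq> {}" using assms by auto
    have "m \<le> dist x y" if y: "y \<in> (\<Union>i\<in>I. ball (c i) r)" for y
    proof -
      obtain i where "i \<in> I" "dist (c i) y < r" using y by auto
      moreover have "m \<le> norm (x - c i) - r"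
        unfolding m_def using assms \<open>i \<in> I\<close> by (intro Min_le) auto
      moreover have "norm (x - c i) \<le> dist x y + dist (c i) y"
        by (metis dist_norm dist_triangle2)
      ultimately show ?thesis by linarith
    qed
    then show ?thesis
      unfolding infdist_notempty[OF ne] using ne by (intro cINF_greatest)
  qed
  ultimately show ?thesis by auto
qed

lemma box_frontier_iff:
  fixes a b x :: "real^'n"
  assumes "box a b \<noteq> {}"
  shows "x \<in> frontier (box a b) \<longleftrightarrow>
    (\<forall>i. a$i \<le> x$i \<and> x$i \<le> b$i) \<and> (\<exists>i. x$i = a$i \<or> x$i = b$i)"
proof -
  have "x \<in> frontier (box a b) \<longleftrightarrow>
    (\<forall>i. a$i \<le> x$i \<and> x$i \<le> b$i) \<and> \<not> (\<forall>i. a$i < x$i \<and> x$i < b$i)"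
    using assms by (simp add: frontier_box mem_box_cart)
  then show ?thesis unfolding less_le by metis
qed

lemma infdist_frontier_box_le:
  fixes a b x :: "real^'n"
  assumes "x \<in> box a b"
  shows "infdist x (frontier (box a b)) \<le> x$i - a$i"
    and "infdist x (frontier (box a b)) \<le> b$i - x$i"
proof -
  have ne: "box a b \<noteq> {}" using assms by auto
  have x: "a$j < x$j" "x$j < b$j" for j using assms by (auto simp: mem_box_cart)
  have *: "infdist x (frontier (box a b)) \<le> \<bar>s - x$i\<bar>" if s: "s = a$i \<or> s = b$i" for s
  proof -
    \<comment> \<open>Moving from \<open>x\<close> parallel to axis \<open>i\<close> reaches the
      face at \<open>s\<close> without leaving the closed box.\<close>
    define y where "y = x + (s - x$i) *\<^sub>R axis i 1"
    have yj: "y $ j = (if j = i then s else x $ j)" for j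
      by (simp add: y_def axis_def)
    have "a $ i \<le> s" "s \<le> b $ i" using s x[of i] by auto
    then have "y \<in> frontier (box a b)"
      unfolding box_frontier_iff[OF ne] using s x by (auto simp: yj less_imp_le)
    moreover have "dist x y = \<bar>s - x$i\<bar>" by (simp add: y_def dist_norm)
    ultimately show ?thesis using infdist_le[of y _ x] by simp
  qed
  show "infdist x (frontier (box a b)) \<le> x$i - a$i"
    and "infdist x (frontier (box a b)) \<le> b$i - x$i"
    using *[of "a$i"] *[of "b$i"] x[of i] by auto
qed

lemma norm_diff_le_box:
  fixes a b x y :: "real^'n"
  assumes "x \<in> box a b" "y \<in> box a b"
  shows "norm (x - y) \<le> norm (b - a)"
proof (rule norm_le_componentwise_cart)
  fix i
  have "a$i < x$i" "x$i < b$i" "a$i < y$i" "y$i < b$i"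
    using assms by (auto simp: mem_box_cart)
  then show "norm ((x - y) $ i) \<le> norm ((b - a) $ i)" by simp
qed

section \<open>Barriers\<close>

locale perforated_box = perforated "box a b" I "\<lambda>i. ball (c i) r" \<epsilon> w
  for a b :: "real^'n" and I c r \<epsilon> w +
  assumes r: "r > 0" and I_ne: "I \<noteq> {}" and balls_sub: "\<And>i. i \<in> I \<Longrightarrow> ball (c i) r \<subseteq> box a b"
begin

abbreviation "d x \<equiv> infdist x (\<Union>i\<in>I. ball (c i) r)"
abbreviation "v x \<equiv> - sqrt \<epsilon> * ln (w x)"

lemma box_ne: "box a b \<noteq> {}"
proof -
  obtain i where "i \<in> I" using I_ne by auto
  then have "c i \<in> box a b" using balls_sub r by (meson centre_in_ball subsetD)
  then show ?thesis by auto
qed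

lemma K_norm_ge: "x \<in> K \<Longrightarrow> i \<in> I \<Longrightarrow> r \<le> norm (x - c i)"
  by (auto simp: dist_norm norm_minus_commute not_less)

lemma K_coord: "x \<in> K \<Longrightarrow> a$j \<le> x$j \<and> x$j \<le> b$j"
  using box_ne by (auto simp: closure_box mem_box_cart)

lemma d_le: "x \<in> K \<Longrightarrow> i \<in> I \<Longrightarrow> d x \<le> norm (x - c i) - r"
  using r by (intro order_trans[OF infdist_mono infdist_ball_le[OF r K_norm_ge]]) auto

lemma centre_notin_U: "i \<in> I \<Longrightarrow> c i \<notin> U"
  using r by force

text \<open>Says that 1 / sqrt \<epsilon> is the rate at which exponentials of a coordinate solve
  the equation exactly.\<close>

lemma inv_h_sq: "\<epsilon> * (1 / sqrt \<epsilon>)\<^sup>2 = 1"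
  using eps by (simp add: power_divide)

lemma le_v_iff: "y \<le> v x \<longleftrightarrow> ln (w x) \<le> - (y / sqrt \<epsilon>)"
  using pos_le_divide_eq[of "sqrt \<epsilon>" "ln (w x)" "- y"] eps by (auto simp: mult.commute)

lemma v_le_iff: "v x \<le> y \<longleftrightarrow> - (y / sqrt \<epsilon>) \<le> ln (w x)"
  using pos_divide_le_eq[of "sqrt \<epsilon>" "- y" "ln (w x)"] eps by (auto simp: mult.commute)

text \<open>The exponential is an exact solution and is at most 1 on \<open>K\<close>, as
  \<open>x$j \<le> b$j\<close> there. It yields positivity of \<open>w\<close>, without which
  \<open>ln\<close> says nothing, and a bound on \<open>v\<close> free of
  \<open>\<epsilon>\<close>.\<close>

lemma coord_lower: "x \<in> K \<Longrightarrow> exp (- ((b$j - x$j) / sqrt \<epsilon>)) \<le> w x"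
proof -
  assume x: "x \<in> K"
  let ?q = "- (b$j / sqrt \<epsilon>)"
  have "exp (1 / sqrt \<epsilon> * x$j + ?q) \<le> w x"
  proof (rule subsolution_le[OF has_laplacian_exp_coord _ _ _ x])
    show "continuous_on K (\<lambda>x. exp (1 / sqrt \<epsilon> * x$j + ?q))"
      by (intro continuous_intros)
    show "exp (1 / sqrt \<epsilon> * y$j + ?q) \<le> \<epsilon> * ((1 / sqrt \<epsilon>)\<^sup>2 * exp (1 / sqrt \<epsilon> * y$j + ?q))" for y
      using inv_h_sq by (simp add: mult.assoc[symmetric])
    show "exp (1 / sqrt \<epsilon> * y$j + ?q) \<le> 1" if "y \<in> K" for y
      using K_coord[OF that, of j] eps by (simp add: field_simps)
  qed
  then show ?thesis by (simp add: diff_divide_distrib)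
qed

lemma w_pos: "x \<in> K \<Longrightarrow> 0 < w x"
  by (rule less_le_trans[OF exp_gt_zero coord_lower])

lemma v_le_coord: "x \<in> K \<Longrightarrow> v x \<le> b$j - x$j"
  unfolding v_le_iff using coord_lower[of x j] w_pos[of x] by (simp add: ln_ge_iff)

lemma v_nonneg: 
  assumes x: "x \<in> K" shows "0 \<le> v x"
proof -
  \<comment> \<open>The constant supersolution 1, written with slope 0 so that the choice of
    coordinate is immaterial.\<close>
  have "w x \<le> exp (0 * x$undefined + 0)"
    by (rule supersolution_ge[OF has_laplacian_exp_coord _ _ _ x]) (auto intro!: continuous_intros)
  then show ?thesis using w_pos[OF x] eps by (simp add: mult_nonneg_nonpos)
qed

text \<open>The radial exponential becomes a subsolution once its rate is raised by (n - 1) / r: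
  this absorbs the curvature term, whose coefficient (n - 1) / \<rho> is at most (n - 1) / r on
  \<open>K\<close>.\<close>

lemma v_le_dist:
  assumes x: "x \<in> K" and i: "i \<in> I"
  shows "v x \<le> (1 + (real CARD('n) - 1) / r * sqrt \<epsilon>) * (norm (x - c i) - r)"
proof -
  define m where "m = (real CARD('n) - 1) / r"
  define s where "s = 1 / sqrt \<epsilon> + m"
  have "real CARD('n) \<ge> 1" by (simp add: Suc_le_eq)
  then have "m \<ge> 0" unfolding m_def using r by simp
  then have "s \<ge> 0" unfolding s_def using eps by simp
  \<comment> \<open>Since s - m = 1 / sqrt \<epsilon>, the left side is 1 + \<epsilon> m / sqrt
    \<epsilon>.\<close>
  have s: "\<epsilon> * (s\<^sup>2 - s * m) \<ge> 1"
  proof -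
    have "\<epsilon> * (s\<^sup>2 - s * m) = \<epsilon> * (1 / sqrt \<epsilon>)\<^sup>2 + \<epsilon> * (m / sqrt \<epsilon>)"
      unfolding s_def by (simp add: power2_eq_square algebra_simps)
    then show ?thesis using eps \<open>m \<ge> 0\<close> unfolding inv_h_sq by simp
  qed
  have "exp (- s * (norm (x - c i) - r)) \<le> w x"
  proof (rule subsolution_le[OF has_laplacian_exp_norm[OF centre_notin_U[OF i]] _ _ _ x])
    show "continuous_on K (\<lambda>x. exp (- s * (norm (x - c i) - r)))"
      by (intro continuous_intros)
    show "exp (- s * (norm (y - c i) - r)) \<le> 1" if "y \<in> K" for y
      using K_norm_ge[OF that i] \<open>s \<ge> 0\<close> by simp
    show "exp (- s * (norm (y - c i) - r)) \<le> \<epsilon> * (exp (- s * (norm (y - c i) - r)) *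
        (s\<^sup>2 - s * (real CARD('n) - 1) / norm (y - c i)))" if "y \<in> U" for y
    proof -
      have \<rho>: "r \<le> norm (y - c i)" by (rule K_norm_ge[OF subsetD[OF U_subset_K that] i])
      have "(real CARD('n) - 1) / norm (y - c i) \<le> m"
        unfolding m_def using \<rho> r \<open>real CARD('n) \<ge> 1\<close> by (intro divide_left_mono mult_pos_pos) auto
      then have "s * (real CARD('n) - 1) / norm (y - c i) \<le> s * m"
        using \<open>s \<ge> 0\<close> by (metis mult_left_mono times_divide_eq_right)
      then have "\<epsilon> * (s\<^sup>2 - s * (real CARD('n) - 1) / norm (y - c i)) \<ge> 1"
        using s eps by (smt (verit) mult_left_mono)
      then show ?thesis
        using mult_left_mono[of 1 "\<epsilon> * (s\<^sup>2 - s * (real CARD('n) - 1) / norm (y - c i))"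
            "exp (- s * (norm (y - c i) - r))"] by (simp add: mult_ac)
    qed
  qed
  then have "- s * (norm (x - c i) - r) \<le> ln (w x)"
    using w_pos[OF x] by (simp add: ln_ge_iff)
  moreover have "(1 + m * sqrt \<epsilon>) * (norm (x - c i) - r) / sqrt \<epsilon> = s * (norm (x - c i) - r)"
    unfolding s_def using eps by (simp add: field_simps)
  ultimately show ?thesis unfolding v_le_iff m_def[symmetric] by simp
qed

lemma v_le_d:
  assumes x: "x \<in> K"
  shows "v x \<le> (1 + (real CARD('n) - 1) / r * sqrt \<epsilon>) * d x"
proof -
  obtain i where i: "i \<in> I" "norm (x - c i) - r \<le> d x"
    using infdist_UN_balls_attained[OF finI I_ne r] by blast
  have "real CARD('n) \<ge> 1" by (simp add: Suc_le_eq)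
  then have "1 + (real CARD('n) - 1) / r * sqrt \<epsilon> \<ge> 0"
    using r eps by simp
  then show ?thesis using v_le_dist[OF x i(1)] mult_left_mono[OF i(2)] order_trans by blast
qed

text \<open>One supersolution for each ball and each face, equal to 1 on its own piece of the
  boundary; their sum dominates \<open>w\<close>. At \<open>x\<close> no summand exceeds exp (- d /
  sqrt \<epsilon>), so the loss is the logarithm of the number of summands.\<close>

lemma d_le_v:
  assumes x: "x \<in> K" "x \<in> box a b" and far: "d x \<le> infdist x (frontier (box a b))"
  shows "d x - sqrt \<epsilon> * ln (card I + 2 * CARD('n)) \<le> v x"
proof -
  have "real CARD('n) \<ge> 1" by (simp add: Suc_le_eq)
  define s where "s = 1 / sqrt \<epsilon>"
  have s: "\<epsilon> * s\<^sup>2 = 1" "s > 0" unfolding s_def using inv_h_sq eps by auto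
  define \<phi> where "\<phi> = (\<lambda>i x. exp (- s * (norm (x - c i) - r)))"
  define lf where "lf = (\<lambda>j (x::real^'n). exp ((- s) * x$j + s * a$j))"
  define rt where "rt = (\<lambda>j (x::real^'n). exp (s * x$j + - (s * b$j)))"
  \<comment> \<open>The three kinds of index stand for balls, lower faces and upper faces.\<close>
  let ?S = "\<lambda>k x. case k of Inl i \<Rightarrow> \<phi> i x | Inr (Inl j) \<Rightarrow> lf j x | Inr (Inr j) \<Rightarrow> rt j x"
  let ?L = "\<lambda>k x. case k of Inl i \<Rightarrow> \<phi> i x * (s\<^sup>2 - s * (real CARD('n) - 1) / norm (x - c i))
     | Inr (Inl j) \<Rightarrow> (- s)\<^sup>2 * lf j x | Inr (Inr j) \<Rightarrow> s\<^sup>2 * rt j x"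
  let ?J = "I <+> (UNIV <+> UNIV) :: (nat + 'n + 'n) set"
  have card: "card ?J = card I + 2 * CARD('n)"
    using finI by (subst card_Plus) (auto simp: card_Plus UNIV_Plus_UNIV[symmetric] simp del: UNIV_Plus_UNIV)
  have pos: "0 < ?S k y" for k y
    by (auto simp: \<phi>_def lf_def rt_def split: sum.split)
  have "w x \<le> (\<Sum>k\<in>?J. ?S k x)"
  proof (rule supersolution_ge[OF has_laplacian_sum _ _ _ x(1)])
    show "has_laplacian (?S k) (?L k) U" if "k \<in> ?J" for k
    proof -
      have "has_laplacian (\<phi> i) (\<lambda>x. \<phi> i x * (s\<^sup>2 - s * (real CARD('n) - 1) / norm (x - c i))) U"
        if "i \<in> I" for i
        unfolding \<phi>_def by (rule has_laplacian_exp_norm[OF centre_notin_U[OF that]])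
      moreover have "has_laplacian (lf j) (\<lambda>x. (- s)\<^sup>2 * lf j x) U" for j
        unfolding lf_def by (rule has_laplacian_exp_coord)
      moreover have "has_laplacian (rt j) (\<lambda>x. s\<^sup>2 * rt j x) U" for j
        unfolding rt_def by (rule has_laplacian_exp_coord)
      ultimately show ?thesis
        using that by (elim PlusE) (simp_all del: power2_minus)
    qed
    show "continuous_on K (\<lambda>x. \<Sum>k\<in>?J. ?S k x)"
    proof (rule continuous_on_sum)
      have "continuous_on K (\<phi> i)" "continuous_on K (lf j)" "continuous_on K (rt j)" for i j
        unfolding \<phi>_def lf_def rt_def by (intro continuous_intros)+
      then show "continuous_on K (?S k)" if "k \<in> ?J" for k
        using that by (elim PlusE) simp_all
    qed
    show "\<epsilon> * (\<Sum>k\<in>?J. ?L k y) \<le> (\<Sum>k\<in>?J. ?S k y)" if "y \<in> U" for y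
      unfolding sum_distrib_left
    proof (rule sum_mono)
      fix k assume k: "k \<in> ?J"
      \<comment> \<open>For a supersolution the curvature term has the favourable sign, so the rate
        needs no correction.\<close>
      have "\<epsilon> * (\<phi> i y * (s\<^sup>2 - s * (real CARD('n) - 1) / norm (y - c i))) \<le> \<phi> i y" for i
      proof -
        have "\<epsilon> * (s * (real CARD('n) - 1) / norm (y - c i)) \<ge> 0"
          using s eps \<open>real CARD('n) \<ge> 1\<close> by simp
        then have "\<epsilon> * (s\<^sup>2 - s * (real CARD('n) - 1) / norm (y - c i)) \<le> 1"
          unfolding right_diff_distrib s(1) by linarith
        then show ?thesis
          using mult_left_mono[of "\<epsilon> * (s\<^sup>2 - s * (real CARD('n) - 1) / norm (y - c i))" 1 "\<phi> i y"]
          by (simp add: mult_ac \<phi>_def)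
      qed
      then show "\<epsilon> * ?L k y \<le> ?S k y"
        using s by (auto simp: mult.assoc[symmetric] split: sum.split)
    qed
    show "1 \<le> (\<Sum>k\<in>?J. ?S k y)" if "y \<in> \<Gamma>" for y
    proof -
      \<comment> \<open>One summand equal to 1 is enough, because all the others are
        positive.\<close>
      have "\<exists>k\<in>?J. ?S k y = 1"
      proof (cases "y \<in> frontier (box a b)")
        case True
        then obtain j where "y$j = a$j \<or> y$j = b$j" using box_frontier_iff[OF box_ne] by auto
        then have "?S (Inr (Inl j)) y = 1 \<or> ?S (Inr (Inr j)) y = 1"
          by (auto simp: lf_def rt_def)
        then show ?thesis by blast
      next
        case False
        then obtain i where "i \<in> I" "y \<in> frontier (ball (c i) r)" using \<open>y \<in> \<Gamma>\<close> by auto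
        then have "?S (Inl i) y = 1"
          using r by (simp add: \<phi>_def dist_norm norm_minus_commute)
        then show ?thesis using \<open>i \<in> I\<close> by blast
      qed
      then obtain k where "k \<in> ?J" "?S k y = 1" by blast
      then show ?thesis
        using member_le_sum[of k ?J "\<lambda>k. ?S k y"] pos finI by (simp add: less_imp_le)
    qed
  qed
  also have "\<dots> \<le> (\<Sum>k\<in>?J. exp (- (s * d x)))"
  proof (rule sum_mono)
    fix k assume "k \<in> ?J"
    have dist: "s * d x \<le> s * z" if "d x \<le> z" for z using that s by simp
    show "?S k x \<le> exp (- (s * d x))"
    proof (cases k)
      case (Inl i)
      then show ?thesis
        using dist[OF d_le[OF x(1)]] \<open>k \<in> ?J\<close> by (auto simp: \<phi>_def)
    next
      case (Inr j)
      \<comment> \<open>Here the size of the box enters: by \<open>far\<close>, every face is at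
        least as far from \<open>x\<close> as the balls are.\<close>
      have "d x \<le> x$j - a$j" "d x \<le> b$j - x$j" for j
        using far infdist_frontier_box_le[OF x(2), of j] by auto
      from dist[OF this(1)] dist[OF this(2)] show ?thesis
        using Inr by (auto simp: lf_def rt_def algebra_simps split: sum.split)
    qed
  qed
  also have "\<dots> = (card I + 2 * CARD('n)) * exp (- (s * d x))"
    unfolding sum_constant card by simp
  finally have "ln (w x) \<le> ln ((card I + 2 * CARD('n)) * exp (- (s * d x)))"
    using w_pos[OF x(1)] by (subst ln_le_cancel_iff) auto
  also have "\<dots> = ln (card I + 2 * CARD('n)) - s * d x"
  proof -
    have "real (card I + 2 * CARD('n)) > 0"
      using \<open>real CARD('n) \<ge> 1\<close> by linarith
    then show ?thesis using ln_mult_pos[OF _ exp_gt_zero] by simp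
  qed
  finally show ?thesis unfolding le_v_iff using eps by (simp add: s_def field_simps)
qed

text \<open>For \<open>\<epsilon> \<le> 1\<close> the one-sided bounds are of order sqrt \<epsilon>,
  which is below the fourth root. For larger \<open>\<epsilon>\<close> the fourth root exceeds 1,
  and \<open>v\<close> and \<open>d\<close> both lie between 0 and the diagonal of the box; this
  accounts for the summand \<open>norm (b - a)\<close> in the constant.\<close>

lemma v_estimate:
  assumes x: "x \<in> K" "x \<in> box a b" and far: "d x \<le> infdist x (frontier (box a b))"
  shows "\<bar>v x - d x\<bar> \<le> (norm (b - a) * (1 + (real CARD('n) - 1) / r) + ln (card I + 2 * CARD('n)))
    * \<epsilon> powr (1/4)"
proof -
  define L where "L = norm (b - a)"
  define m where "m = (real CARD('n) - 1) / r"
  define q where "q = ln (card I + 2 * CARD('n))"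
  have n1: "real CARD('n) \<ge> 1" by (simp add: Suc_le_eq)
  have "L \<ge> 0" "m \<ge> 0"
    using r n1 unfolding L_def m_def by auto
  have "q \<ge> 0"
    using n1 unfolding q_def by (intro ln_ge_zero) linarith
  obtain i where i: "i \<in> I" using I_ne by auto
  then have "c i \<in> box a b" using balls_sub r by (meson centre_in_ball subsetD)
  then have dL: "d x \<le> L"
    using d_le[OF x(1) i] norm_diff_le_box[OF x(2)] r unfolding L_def by fastforce
  have "\<bar>v x - d x\<bar> \<le> (L * (1 + m) + q) * \<epsilon> powr (1/4)"
  proof (cases "\<epsilon> \<le> 1")
    case True
    have h: "sqrt \<epsilon> \<le> \<epsilon> powr (1/4)"
      using eps True by (auto simp: powr_half_sqrt[symmetric] intro!: powr_mono')
    have "v x - d x \<le> m * d x * sqrt \<epsilon>" "d x - v x \<le> q * sqrt \<epsilon>"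
      using v_le_d[OF x(1)] d_le_v[OF x far] unfolding m_def q_def by (auto simp: algebra_simps)
    moreover have "m * d x * sqrt \<epsilon> \<le> m * L * sqrt \<epsilon>"
      using dL \<open>m \<ge> 0\<close> eps by (intro mult_right_mono mult_left_mono) auto
    moreover have "m * L * sqrt \<epsilon> \<le> m * L * \<epsilon> powr (1/4)" "q * sqrt \<epsilon> \<le> q * \<epsilon> powr (1/4)"
      using h \<open>L \<ge> 0\<close> \<open>m \<ge> 0\<close> \<open>q \<ge> 0\<close> by (auto intro!: mult_left_mono)
    moreover have "0 \<le> L * \<epsilon> powr (1/4)" "0 \<le> m * L * \<epsilon> powr (1/4)" "0 \<le> q * \<epsilon> powr (1/4)"
      using \<open>L \<ge> 0\<close> \<open>m \<ge> 0\<close> \<open>q \<ge> 0\<close> by auto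
    moreover have "(L * (1 + m) + q) * \<epsilon> powr (1/4) =
        L * \<epsilon> powr (1/4) + m * L * \<epsilon> powr (1/4) + q * \<epsilon> powr (1/4)"
      by (simp add: algebra_simps)
    ultimately show ?thesis by linarith
  next
    case False
    obtain j :: 'n where True by simp
    have "b$j - x$j \<le> \<bar>(b - a)$j\<bar>" using K_coord[OF x(1), of j] by simp
    also have "\<dots> \<le> L" unfolding L_def by (rule component_le_norm_cart)
    finally have "\<bar>v x - d x\<bar> \<le> L"
      using v_le_coord[OF x(1), of j] v_nonneg[OF x(1)] dL infdist_nonneg[of x "\<Union>i\<in>I. ball (c i) r"]
      by linarith
    also have "\<dots> \<le> (L * (1 + m) + q) * 1"
      using \<open>L \<ge> 0\<close> \<open>m \<ge> 0\<close> \<open>q \<ge> 0\<close> by (simp add: algebra_simps)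
    also have "\<dots> \<le> (L * (1 + m) + q) * \<epsilon> powr (1/4)"
      using False \<open>L \<ge> 0\<close> \<open>m \<ge> 0\<close> \<open>q \<ge> 0\<close> by (intro mult_left_mono ge_one_powr_ge_zero) auto
    finally show ?thesis .
  qed
  then show ?thesis unfolding L_def m_def q_def .
qed

end

section \<open>A constant uniform in \<Omega> and \<epsilon>, and the limit\<close>

theorem lemma3p2:
  fixes D :: "(real^'n) set" and B :: "nat \<Rightarrow> (real^'n) set" and N :: nat and r :: real
  assumes "N \<ge> 1" and "r > 0"
    and balls: "\<forall>i\<in>{1..N}. \<exists>c. B i = ball c r"
    and disj: "disjoint_family_on B {1..N}"
    and box: "\<exists>a b. D = box a b"
  shows "\<exists>C::real. \<forall>(\<Omega> :: (real^'n) set) (w :: real \<Rightarrow> real^'n \<Rightarrow> real).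
           open \<Omega> \<and> bounded \<Omega> \<and> (\<forall>i\<in>{1..N}. B i \<subseteq> \<Omega>) \<and> \<Omega> \<subseteq> D \<and>
           (\<forall>x\<in>\<Omega>. infdist x (\<Union>i\<in>{1..N}. B i) < infdist x (frontier D)) \<and>
           (\<forall>\<epsilon>>0. classical_solution D {1..N} B \<epsilon> (w \<epsilon>)) \<longrightarrow>
           uniform_limit (\<Omega> - (\<Union>i\<in>{1..N}. B i))
             (\<lambda>\<epsilon> x. - sqrt \<epsilon> * ln (w \<epsilon> x))
             (\<lambda>x. infdist x (\<Union>i\<in>{1..N}. B i)) (at_right 0) \<and>
           (\<forall>\<epsilon>>0. \<forall>x \<in> \<Omega> - (\<Union>i\<in>{1..N}. B i).
              \<bar>- sqrt \<epsilon> * ln (w \<epsilon> x) - infdist x (\<Union>i\<in>{1..N}. B i)\<bar> \<le> C * \<epsilon> powr (1/4))"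
proof -
  obtain c where c: "\<forall>i\<in>{1..N}. B i = ball (c i) r" using balls by metis
  obtain a b where D: "D = box a b" using box by auto
  \<comment> \<open>Fixed before \<Omega> and \<open>w\<close> are introduced: it involves only the
    box, the radius, the number of balls and the dimension.\<close>
  define C where "C = norm (b - a) * (1 + (real CARD('n) - 1) / r)
    + ln (card {1..N} + 2 * CARD('n))"
  have UB: "(\<Union>i\<in>{1..N}. B i) = (\<Union>i\<in>{1..N}. ball (c i) r)" using c by auto
  show ?thesis
  proof (intro exI[of _ C] allI impI)
    fix \<Omega> :: "(real^'n) set" and w :: "real \<Rightarrow> real^'n \<Rightarrow> real"
    assume H: "open \<Omega> \<and> bounded \<Omega> \<and> (\<forall>i\<in>{1..N}. B i \<subseteq> \<Omega>) \<and> \<Omega> \<subseteq> D \<and>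
           (\<forall>x\<in>\<Omega>. infdist x (\<Union>i\<in>{1..N}. B i) < infdist x (frontier D)) \<and>
           (\<forall>\<epsilon>>0. classical_solution D {1..N} B \<epsilon> (w \<epsilon>))"
    have est: "\<bar>- sqrt \<epsilon> * ln (w \<epsilon> x) - infdist x (\<Union>i\<in>{1..N}. B i)\<bar> \<le> C * \<epsilon> powr (1/4)"
      if "\<epsilon> > 0" and x: "x \<in> \<Omega> - (\<Union>i\<in>{1..N}. B i)" for \<epsilon> x
    proof -
      have "classical_solution D {1..N} B \<epsilon> (w \<epsilon>)" using H \<open>\<epsilon> > 0\<close> by blast
      then have "classical_solution (box a b) {1..N} (\<lambda>i. ball (c i) r) \<epsilon> (w \<epsilon>)"
        using c unfolding classical_solution_def D by simp
      \<comment> \<open>The inclusion passes through \<Omega>.\<close>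
      moreover have "ball (c i) r \<subseteq> box a b" if "i \<in> {1..N}" for i
        using H c D that by (metis order_trans)
      ultimately interpret perforated_box a b "{1..N}" c r \<epsilon> "w \<epsilon>"
        using \<open>r > 0\<close> \<open>N \<ge> 1\<close> \<open>\<epsilon> > 0\<close> by unfold_locales (auto simp: open_box)
      have "x \<in> box a b" using H x D by auto
      moreover have "x \<in> K" using \<open>x \<in> box a b\<close> x closure_subset unfolding UB by blast
      moreover have "d x \<le> infdist x (frontier (box a b))"
        using H x D unfolding UB by (simp add: less_imp_le)
      ultimately show ?thesis using v_estimate[of x] unfolding C_def UB by blast
    qed
    have "uniform_limit (\<Omega> - (\<Union>i\<in>{1..N}. B i)) (\<lambda>\<epsilon> x. - sqrt \<epsilon> * ln (w \<epsilon> x))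
             (\<lambda>x. infdist x (\<Union>i\<in>{1..N}. B i)) (at_right 0)"
    proof (rule uniform_limitI)
      fix e :: real assume "e > 0"
      \<comment> \<open>Side condition for the limit of \<open>powr\<close> as its base tends to
        0.\<close>
      have "eventually (\<lambda>\<epsilon>::real. 0 \<le> \<epsilon>) (at_right 0)"
        using eventually_at_right_less[of "0::real"] by eventually_elim simp
      then have "((\<lambda>\<epsilon>::real. C * \<epsilon> powr (1/4)) \<longlongrightarrow> C * 0) (at_right 0)"
        by (intro tendsto_mult tendsto_const) (auto intro!: tendsto_eq_intros)
      then have "eventually (\<lambda>\<epsilon>. C * \<epsilon> powr (1/4) < e) (at_right 0)"
        using \<open>e > 0\<close> by (intro order_tendstoD(2)) auto
      then show "\<forall>\<^sub>F \<epsilon> in at_right 0. \<forall>x\<in>\<Omega> - (\<Union>i\<in>{1..N}. B i).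
          dist (- sqrt \<epsilon> * ln (w \<epsilon> x)) (infdist x (\<Union>i\<in>{1..N}. B i)) < e"
        using eventually_at_right_less[of "0::real"]
      proof eventually_elim
        case (elim \<epsilon>)
        then show ?case using est[OF elim(2)] by (fastforce simp: dist_real_def)
      qed
    qed
    with est show "uniform_limit (\<Omega> - (\<Union>i\<in>{1..N}. B i)) (\<lambda>\<epsilon> x. - sqrt \<epsilon> * ln (w \<epsilon> x))
             (\<lambda>x. infdist x (\<Union>i\<in>{1..N}. B i)) (at_right 0) \<and>
           (\<forall>\<epsilon>>0. \<forall>x \<in> \<Omega> - (\<Union>i\<in>{1..N}. B i).
              \<bar>- sqrt \<epsilon> * ln (w \<epsilon> x) - infdist x (\<Union>i\<in>{1..N}. B i)\<bar> \<le> C * \<epsilon> powr (1/4))"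
      by blast
  qed
qed

end
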